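(* For integers $1\le m\le l$ let $$H^{(l,m)}(x,y,z) = \left[\frac{2(l-m)!}{(l+m)!}\right]^{1/2}\Pi_l^m(x,r)\,B_m(y,z),\qquad r=\sqrt{x^2+y^2+z^2},$$ with $\Pi_l^m$ and $B_m$ as defined in the context. Then on the $xy$-plane, $$\nabla H^{(l,m)}(x,y,0)=\left(0,0,\frac{\partial H^{(l,m)}}{\partial z}(x,y,0)\right)=:(0,0,F^{(l,m)}(x,y)),$$ and for every integer $p\ge 1$, $$\operatorname{span}\{F^{(l,m)} : l=1,\ldots,p,\ m=1,\ldots,l\}=\operatorname{span}\{x^iy^j : i,j\ge 0,\ 0\le i+j\le p-1\}.$$ In other words, the functions $F^{(l,m)}$ ($l=1,\ldots,p$, $m=1,\ldots,l$) form a complete and linearly independent set (a basis) for the space $\operatorname{span}\{x^iy^j : 0\le i+j\le p-1\}$ used in $p$th order polynomial approximation on the $xy$-plane.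
   Context: For integers $1\le m\le l$: $$B_m(y,z)=\frac{1}{2i}\left[(y+iz)^m-(y-iz)^m\right],$$ $$\Pi_l^m(x,r)=r^{l-m}\,\frac{d^mP_l(u)}{du^m}\Big|_{u=x/r}=\sum_{k=0}^{\lfloor(l-m)/2\rfloor}\gamma_{lk}^{(m)}\,r^{2k}x^{l-2k-m},$$ where $P_l$ is the Legendre polynomial of degree $l$ and $$\gamma_{lk}^{(m)}=(-1)^k2^{-l}\binom{l}{k}\binom{2l-2k}{l}\frac{(l-2k)!}{(l-2k-m)!}.$$ With $r^2=x^2+y^2+z^2$ substituted, $\Pi_l^m(x,r)$ is a polynomial in $(x,y,z)$. Here $\nabla$ is the gradient with respect to $(x,y,z)$, and $\nabla H^{(l,m)}(x,y,0)$ means the gradient of $H^{(l,m)}$ evaluated at the point $(x,y,0)$. *)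

theory Defs
  imports "HOL-Analysis.Analysis" "HOL-Library.Function_Algebras"
    "HOL-Computational_Algebra.Polynomial"
begin

text \<open>The pointwise vector space structure on functions, so that the library's \<open>span\<close> and
  \<open>independent\<close> apply to sets of real functions; addition is that of \<open>Function_Algebras\<close>.\<close>

instantiation "fun" :: (type, real_vector) real_vector
begin

definition scaleR_fun :: "real \<Rightarrow> ('a \<Rightarrow> 'b) \<Rightarrow> 'a \<Rightarrow> 'b" where
  "scaleR_fun c f = (\<lambda>x. c *\<^sub>R f x)"

instance
  by standard (simp_all add: scaleR_fun_def fun_eq_iff scaleR_add_right scaleR_add_left)

end

text \<open>Rodrigues' formula.\<close>

definition legendre :: "nat \<Rightarrow> real poly" where
  "legendre l = smult (1 / (2 ^ l * fact l)) ((pderiv ^^ l) ([:-1, 0, 1:] ^ l))"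

text \<open>At \<open>r = 0\<close> the junk value \<open>x / 0 = 0\<close> does no harm for the points in question, where
  \<open>x = 0\<close> as well: \<open>Pi_poly_eq_sum\<close> below holds there too.\<close>

definition Pi_poly :: "nat \<Rightarrow> nat \<Rightarrow> real \<Rightarrow> real \<Rightarrow> real" where
  "Pi_poly l m x r = r ^ (l - m) * poly ((pderiv ^^ m) (legendre l)) (x / r)"

definition gamma_coeff :: "nat \<Rightarrow> nat \<Rightarrow> nat \<Rightarrow> real" where
  "gamma_coeff l m k = (-1) ^ k / 2 ^ l * real (l choose k) * real ((2 * l - 2 * k) choose l)
     * fact (l - 2 * k) / fact (l - 2 * k - m)"

lemma higher_pderiv_monom_fact:
  fixes c :: real
  assumes "k \<le> n"
  shows "(pderiv ^^ k) (monom c n) = monom (fact n / fact (n - k) * c) (n - k)"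
proof (rule poly_eqI)
  fix j
  have "(fact n :: real) = fact j * pochhammer (1 + of_nat j) k" if "n = j + k"
    unfolding that pochhammer_fact by (rule pochhammer_product')
  thus "coeff ((pderiv ^^ k) (monom c n)) j = coeff (monom (fact n / fact (n - k) * c) (n - k)) j"
    using assms by (auto simp: coeff_higher_pderiv)
qed

lemma Legendre_higher_pderiv:
  assumes "m \<le> l"
  shows "(pderiv ^^ m) (legendre l) =
    (\<Sum>k\<le>(l - m) div 2. monom (gamma_coeff l m k) (l - 2 * k - m))"
proof -
  have "[:-1, 0, 1:] ^ l = (monom (-1) 0 + monom (1::real) 2) ^ l"
    by (simp add: monom_altdef power2_eq_square)
  also have "\<dots> = (\<Sum>k\<le>l. monom ((-1) ^ k * real (l choose k)) (2 * l - 2 * k))"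
    unfolding binomial_ring
    by (intro sum.cong refl)
      (simp add: monom_power mult_monom of_nat_monom diff_mult_distrib mult.commute)
  finally have *: "[:-1, 0, 1:] ^ l =
    (\<Sum>k\<le>l. monom ((-1) ^ k * real (l choose k)) (2 * l - 2 * k))" .
  have "(pderiv ^^ m) (legendre l) = smult (1 / (2 ^ l * fact l))
      (\<Sum>k\<le>l. (pderiv ^^ (m + l)) (monom ((-1) ^ k * real (l choose k)) (2 * l - 2 * k)))"
    unfolding legendre_def higher_pderiv_smult * by (simp add: funpow_add higher_pderiv_sum)
  also have "\<dots> = (\<Sum>k\<le>l. smult (1 / (2 ^ l * fact l))
      ((pderiv ^^ (m + l)) (monom ((-1) ^ k * real (l choose k)) (2 * l - 2 * k))))"
    by (simp add: poly_eq_iff coeff_sum sum_distrib_left)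
  also have "\<dots> = (\<Sum>k\<le>(l - m) div 2. monom (gamma_coeff l m k) (l - 2 * k - m))"
  proof (rule sum.mono_neutral_cong_right)
    show "\<forall>i\<in>{..l} - {..(l - m) div 2}. smult (1 / (2 ^ l * fact l))
      ((pderiv ^^ (m + l)) (monom ((-1) ^ i * real (l choose i)) (2 * l - 2 * i))) = 0"
      using assms by (auto simp: poly_eq_iff coeff_higher_pderiv)
  next
    fix k assume "k \<in> {..(l - m) div 2}"
    hence k: "2 * k + m \<le> l" using assms by auto
    hence "l \<le> 2 * l - 2 * k" "2 * l - 2 * k - l = l - 2 * k"
      "2 * l - 2 * k - (m + l) = l - 2 * k - m" "m + l \<le> 2 * l - 2 * k"
      by auto
    thus "smult (1 / (2 ^ l * fact l))
        ((pderiv ^^ (m + l)) (monom ((-1) ^ k * real (l choose k)) (2 * l - 2 * k))) =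
        monom (gamma_coeff l m k) (l - 2 * k - m)"
      by (simp add: higher_pderiv_monom_fact smult_monom gamma_coeff_def binomial_fact[of l])
  qed auto
  finally show ?thesis .
qed

lemma Pi_poly_eq_sum:
  assumes "m \<le> l" and "r = 0 \<Longrightarrow> x = 0"
  shows "Pi_poly l m x r =
    (\<Sum>k\<le>(l - m) div 2. gamma_coeff l m k * r ^ (2 * k) * x ^ (l - 2 * k - m))"
  unfolding Pi_poly_def Legendre_higher_pderiv[OF assms(1)] poly_sum poly_monom sum_distrib_left
proof (rule sum.cong[OF refl])
  fix k assume "k \<in> {..(l - m) div 2}"
  hence k: "l - m = 2 * k + (l - 2 * k - m)" using assms(1) by auto
  have "r ^ (l - m) * (x / r) ^ (l - 2 * k - m) = r ^ (2 * k) * x ^ (l - 2 * k - m)"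
  proof (cases "r = 0")
    case True
    with assms(2) have "x = 0" by simp
    with True k show ?thesis by (auto simp: power_0_left)
  next
    case False
    thus ?thesis by (subst k) (simp add: power_add power_divide)
  qed
  thus "r ^ (l - m) * (gamma_coeff l m k * (x / r) ^ (l - 2 * k - m)) =
    gamma_coeff l m k * r ^ (2 * k) * x ^ (l - 2 * k - m)"
    by (simp add: mult_ac)
qed

text \<open>The complex expression is real-valued (\<open>of_real_B_poly\<close>), so \<open>Re\<close> only changes the type.\<close>

definition B_poly :: "nat \<Rightarrow> real \<Rightarrow> real \<Rightarrow> real" where
  "B_poly m y z = Re (1 / (2 * \<i>) *
     ((complex_of_real y + \<i> * complex_of_real z) ^ m
      - (complex_of_real y - \<i> * complex_of_real z) ^ m))"

lemma of_real_B_poly: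
  "complex_of_real (B_poly m y z) = 1 / (2 * \<i>) *
     ((complex_of_real y + \<i> * complex_of_real z) ^ m
      - (complex_of_real y - \<i> * complex_of_real z) ^ m)" (is "_ = ?c")
proof -
  have "cnj ?c = ?c" by (simp add: field_simps)
  hence "?c \<in> \<real>" by (simp only: Reals_cnj_iff)
  thus ?thesis unfolding B_poly_def by (rule of_real_Re)
qed

definition H_fun :: "nat \<Rightarrow> nat \<Rightarrow> real \<times> real \<times> real \<Rightarrow> real" where
  "H_fun l m = (\<lambda>(x, y, z). sqrt (2 * fact (l - m) / fact (l + m))
     * Pi_poly l m x (sqrt (x\<^sup>2 + y\<^sup>2 + z\<^sup>2)) * B_poly m y z)"

definition F_fun :: "nat \<Rightarrow> nat \<Rightarrow> real \<times> real \<Rightarrow> real" where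
  "F_fun l m = (\<lambda>(x, y). deriv (\<lambda>z. H_fun l m (x, y, z)) 0)"

end

theory Submission
  imports Defs
begin

text \<open>On \<open>z = 0\<close> the factor \<open>B_m\<close> vanishes to first order with \<open>\<partial>B_m/\<partial>z = m y^(m-1)\<close>, so \<open>F\<close> is a
  constant multiple of \<open>y^(m-1) \<Pi>_l^m(x, r)\<close> with \<open>r\<^sup>2 = x\<^sup>2 + y\<^sup>2\<close>. This is homogeneous of degree
  \<open>l - 1\<close>, and its lowest power of \<open>y\<close> is \<open>x^(l-m) y^(m-1)\<close>, with a coefficient proportional to the
  \<open>m\<close>-th derivative of \<open>P_l\<close> at \<open>1\<close>, which is nonzero. In each degree the \<open>F\<close> are hence triangular
  in the monomials, so they span the same space; as there are as many of them as there are
  (linearly independent) monomials, they are independent.\<close>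

definition bimonom :: "nat \<Rightarrow> nat \<Rightarrow> real \<times> real \<Rightarrow> real" where
  "bimonom i j = (\<lambda>(x, y). x ^ i * y ^ j)"

lemma sum_fun_apply: "(\<Sum>i\<in>A. f i) x = (\<Sum>i\<in>A. f i x)"
  by (induction A rule: infinite_finite_induct) auto

lemma scaleR_fun_apply: "(c *\<^sub>R f) x = c *\<^sub>R f x"
  by (simp add: scaleR_fun_def)

subsection \<open>Linear independence of the monomials\<close>

text \<open>A real polynomial vanishing everywhere is zero; this is applied twice, first in
  \<open>y\<close> with \<open>x\<close> fixed, then in \<open>x\<close> to the coefficient of
  \<open>y ^ j\<close>.\<close>

lemma bivariate_poly_eq_0_imp_coeff_eq_0:
  fixes c :: "nat \<times> nat \<Rightarrow> real"
  assumes A: "finite A" and zero: "\<And>x y. (\<Sum>(i, j)\<in>A. c (i, j) * (x ^ i * y ^ j)) = 0"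
    and ij: "(i, j) \<in> A"
  shows "c (i, j) = 0"
proof -
  have x: "(\<Sum>a\<in>A. if snd a = j then c a * x ^ fst a else 0) = 0" for x
  proof -
    define q where "q = (\<Sum>a\<in>A. monom (c a * x ^ fst a) (snd a))"
    have "poly q y = 0" for y
      using zero[of x y] by (simp add: q_def poly_sum poly_monom case_prod_unfold mult_ac)
    hence "q = 0" using poly_all_0_iff_0 by blast
    hence "coeff q j = 0" by simp
    thus ?thesis by (simp add: q_def coeff_sum)
  qed
  define q where "q = (\<Sum>a\<in>A. monom (if snd a = j then c a else 0) (fst a))"
  have "poly q t = (\<Sum>a\<in>A. if snd a = j then c a * t ^ fst a else 0)" for t
    unfolding q_def poly_sum by (intro sum.cong) (auto simp: poly_monom)
  hence "poly q t = 0" for t using x by simp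
  hence "q = 0" using poly_all_0_iff_0 by blast
  hence "coeff q i = 0" by simp
  hence "(\<Sum>a\<in>A. if a = (i, j) then c a else 0) = 0"
    unfolding q_def coeff_sum by (smt (verit) coeff_monom prod.collapse prod.sel sum.cong)
  thus ?thesis using A ij by simp
qed

lemma inj_bimonom: "inj (case_prod bimonom)"
proof (rule injI, clarify)
  fix i j k l :: nat
  assume eq: "bimonom i j = bimonom k l"
  show "i = k \<and> j = l"
    \<comment> \<open>The two points isolate the exponents: \<open>2 ^ i = 2 ^ k\<close> and
      \<open>2 ^ j = 2 ^ l\<close>.\<close>
    using fun_cong[OF eq, of "(2, 1)"] fun_cong[OF eq, of "(1, 2)"] by (simp add: bimonom_def)
qed

lemma independent_bimonom:
  assumes "finite A"
  shows "independent (case_prod bimonom ` A)"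
proof (rule independent_if_scalars_zero)
  show "finite (case_prod bimonom ` A)" using assms by simp
next
  fix u f
  assume zero: "(\<Sum>g\<in>case_prod bimonom ` A. u g *\<^sub>R g) = 0" and f: "f \<in> case_prod bimonom ` A"
  then obtain i j where ij: "(i, j) \<in> A" "f = bimonom i j" by auto
  \<comment> \<open>The scalars \<open>u\<close> are indexed by functions; injectivity turns them
    into coefficients indexed by exponent pairs.\<close>
  have inj: "inj_on (case_prod bimonom) A" using inj_bimonom inj_on_subset by blast
  have "(\<Sum>a\<in>A. u (case_prod bimonom a) *\<^sub>R case_prod bimonom a) = 0"
    using zero by (simp add: sum.reindex[OF inj])
  hence "(\<Sum>(i, j)\<in>A. u (case_prod bimonom (i, j)) * (x ^ i * y ^ j)) = 0" for x y
    by (drule_tac fun_cong[where x = "(x, y)"])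
      (simp add: sum_fun_apply scaleR_fun_apply case_prod_unfold bimonom_def)
  from bivariate_poly_eq_0_imp_coeff_eq_0[OF assms this ij(1)]
  show "u f = 0" using ij(2) by simp
qed

subsection \<open>Spanning sets of minimal cardinality\<close>

text \<open>Dropping a redundant element of \<open>T\<close> would leave the span unchanged with
  fewer than \<open>card S\<close> elements, against the exchange bound for the independent set
  \<open>S\<close>.\<close>

lemma (in vector_space) independent_card_le_spanning:
  assumes "finite T" "independent S" "S \<subseteq> span T" "card T \<le> card S"
  shows "independent T"
proof
  assume "dependent T"
  then obtain a where a: "a \<in> T" "a \<in> span (T - {a})" unfolding dependent_def by blast
  have "span T = span (T - {a})" using span_redundant[OF a(2)] a(1) by (simp add: insert_absorb)
  hence "card S \<le> card (T - {a})"
    using independent_span_bound[of "T - {a}" S] assms by auto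
  also have "\<dots> < card T" using assms(1) a(1) by (rule card_Diff1_less)
  finally show False using assms(4) by simp
qed

subsection \<open>Derivatives of Legendre polynomials at 1\<close>

text \<open>Serves to move the evaluation point \<open>c\<close> to 0, where derivatives are read
  off from coefficients. The inner polynomial has slope 1, so the chain rule adds no factor.\<close>

lemma higher_pderiv_pcompose_shift:
  fixes p :: "real poly"
  shows "(pderiv ^^ n) (p \<circ>\<^sub>p [:c, 1:]) = (pderiv ^^ n) p \<circ>\<^sub>p [:c, 1:]"
  by (induction n) (simp_all add: pderiv_pcompose pderiv_pCons)

lemma poly_higher_pderiv_0:
  fixes p :: "real poly"
  shows "poly ((pderiv ^^ n) p) 0 = fact n * coeff p n"
  by (simp add: poly_0_coeff_0 coeff_higher_pderiv pochhammer_fact)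

lemma pcompose_power: "(p ^ n) \<circ>\<^sub>p q = (p \<circ>\<^sub>p q) ^ n"
  by (induction n) (simp_all add: pcompose_mult pcompose_1)

text \<open>For \<open>u = 1 + t\<close>, the power \<open>(u^2 - 1) ^ l\<close> in Rodrigues'
  formula is \<open>t ^ l * (t + 2) ^ l\<close>. Its derivative of order \<open>m + l\<close> at
  \<open>t = 0\<close> is \<open>fact (m + l)\<close> times the coefficient of \<open>t ^ m\<close>
  in \<open>(t + 2) ^ l\<close>, which is positive.\<close>

lemma Legendre_higher_pderiv_1_neq_0:
  assumes "m \<le> l"
  shows "poly ((pderiv ^^ m) (legendre l)) 1 \<noteq> 0"
proof -
  let ?q = "[:-1, 0, 1:] ^ l :: real poly"
  have shift: "?q \<circ>\<^sub>p [:1, 1:] = monom 1 l * [:2, 1:] ^ l"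
  proof -
    have "[:-1, 0, 1:] \<circ>\<^sub>p [:1, 1:] = [:0, 1::real:] * [:2, 1:]"
      by (simp add: pcompose_pCons)
    hence "?q \<circ>\<^sub>p [:1, 1:] = [:0, 1:] ^ l * [:2, 1:] ^ l"
      by (simp only: pcompose_power power_mult_distrib)
    thus ?thesis by (simp add: monom_altdef)
  qed
  have "poly ((pderiv ^^ m) (legendre l)) 1
      = 1 / (2 ^ l * fact l) * poly ((pderiv ^^ (m + l)) ?q) 1"
    by (simp add: legendre_def higher_pderiv_smult funpow_add)
  also have "poly ((pderiv ^^ (m + l)) ?q) 1
      = poly ((pderiv ^^ (m + l)) (?q \<circ>\<^sub>p [:1, 1:])) 0"
    by (simp add: higher_pderiv_pcompose_shift poly_pcompose)
  also have "\<dots> = fact (m + l) * coeff ([:2, 1:] ^ l) m"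
    unfolding poly_higher_pderiv_0 shift by (simp add: coeff_monom_mult)
  also have "coeff ([:2, 1:] ^ l) m = real (l choose m) * 2 ^ (l - m)"
    using coeff_linear_poly_power[OF assms, of "2 :: real" 1] by simp
  finally show ?thesis using assms by simp
qed

text \<open>The sum is the \<open>m\<close>-th derivative of the Legendre polynomial at 1, where
  every monomial has value 1.\<close>

lemma sum_gamma_coeff_neq_0:
  assumes "m \<le> l"
  shows "(\<Sum>k\<le>(l - m) div 2. gamma_coeff l m k) \<noteq> 0"
  using Legendre_higher_pderiv_1_neq_0[OF assms]
  by (simp add: Legendre_higher_pderiv[OF assms] poly_sum poly_monom)

subsection \<open>The gradient on the plane\<close>

text \<open>The two powers are conjugate to each other. A single power is simpler to
  differentiate.\<close>

lemma B_poly_eq_Im: "B_poly m y z = Im ((of_real y + \<i> * of_real z) ^ m)"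
proof -
  define w where "w = of_real y + \<i> * of_real z"
  have "of_real y - \<i> * of_real z = cnj w" by (simp add: w_def)
  hence "B_poly m y z = Re (1 / (2 * \<i>) * (w ^ m - cnj (w ^ m)))"
    by (simp add: B_poly_def w_def)
  also have "w ^ m - cnj (w ^ m) = 2 * \<i> * of_real (Im (w ^ m))"
    by (rule complex_diff_cnj[THEN trans]) (simp add: mult_ac)
  finally show ?thesis by (simp add: w_def)
qed

lemma B_poly_has_derivative:
  "((\<lambda>(x, y, z). B_poly m y z) has_derivative (\<lambda>(a, b, c). real m * y ^ (m - 1) * c))
     (at (x, y, 0))"
proof -
  have "((\<lambda>v. Im ((of_real (fst (snd v)) + \<i> * of_real (snd (snd v))) ^ m)) has_derivative
      (\<lambda>h. Im (of_nat m * (of_real (fst (snd h)) + \<i> * of_real (snd (snd h))) * of_real y ^ (m - 1))))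
      (at (x, y, 0))"
    by (auto intro!: derivative_eq_intros simp: mult_ac)
  \<comment> \<open>At \<open>z = 0\<close> the base of the power is real, so only the increment
    \<open>c\<close> contributes to the imaginary part.\<close>
  moreover have "Im (of_nat m * (of_real b + \<i> * of_real c) * of_real y ^ (m - 1))
      = real m * y ^ (m - 1) * c" for b c
    by (simp flip: of_real_power)
  ultimately show ?thesis by (simp add: B_poly_eq_Im case_prod_unfold mult_ac)
qed

text \<open>Product rule at a zero of \<open>B_poly\<close>: the derivative of the other factor is
  multiplied by 0, so its mere existence suffices.\<close>

lemma H_fun_has_derivative:
  assumes "m \<le> l"
  shows "(H_fun l m has_derivative (\<lambda>(a, b, c). sqrt (2 * fact (l - m) / fact (l + m))
    * Pi_poly l m x (sqrt (x\<^sup>2 + y\<^sup>2)) * (real m * y ^ (m - 1)) * c)) (at (x, y, 0))"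
proof (cases "m = 0")
  case True
  have "H_fun l m = (\<lambda>_. 0)" by (auto simp: H_fun_def B_poly_def True)
  thus ?thesis by (simp add: True case_prod_unfold)
next
  case False
  define N where "N = sqrt (2 * fact (l - m) / fact (l + m) :: real)"
  \<comment> \<open>Writing \<open>r ^ (2 * k)\<close> as a power of the sum of squares removes the
    square root and the quotient \<open>x / r\<close>, so \<open>G\<close> is differentiable at the
    origin as well.\<close>
  define G :: "real \<times> real \<times> real \<Rightarrow> real" where "G = (\<lambda>v. N * (\<Sum>k\<le>(l - m) div 2. gamma_coeff l m k
    * ((fst v)\<^sup>2 + (fst (snd v))\<^sup>2 + (snd (snd v))\<^sup>2) ^ k * fst v ^ (l - 2 * k - m)))"
  have G: "N * Pi_poly l m a (sqrt (a\<^sup>2 + b\<^sup>2 + c\<^sup>2)) = G (a, b, c)" for a b c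
  proof -
    have "a\<^sup>2 + b\<^sup>2 + c\<^sup>2 = 0 \<Longrightarrow> a = 0" by (simp add: add_nonneg_eq_0_iff)
    thus ?thesis
      by (subst Pi_poly_eq_sum[OF assms]) (auto simp: G_def power_mult)
  qed
  have H: "H_fun l m = (\<lambda>v. G v * (\<lambda>(x, y, z). B_poly m y z) v)"
    by (auto simp: H_fun_def N_def[symmetric] G fun_eq_iff)
  have "G differentiable at (x, y, 0)"
    unfolding G_def
    by (intro differentiable_mult differentiable_sum differentiable_add differentiable_power
        differentiable_const bounded_linear_imp_differentiable bounded_linear_fst
        bounded_linear_fst_comp[OF bounded_linear_snd] bounded_linear_snd_comp[OF bounded_linear_snd]
        finite_atMost ballI)
  then obtain G' where G': "(G has_derivative G') (at (x, y, 0))"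
    unfolding differentiable_def by blast
  have "B_poly m y 0 = 0" by (simp add: B_poly_def)
  with has_derivative_mult[OF G' B_poly_has_derivative[of m y x]]
  show ?thesis unfolding H using G[of x y 0]
    by (simp add: case_prod_unfold N_def[symmetric] mult_ac)
qed

lemma F_fun_eq:
  assumes "m \<le> l"
  shows "F_fun l m (x, y) = sqrt (2 * fact (l - m) / fact (l + m))
    * Pi_poly l m x (sqrt (x\<^sup>2 + y\<^sup>2)) * (real m * y ^ (m - 1))" (is "_ = ?D")
proof -
  have "((\<lambda>z. (x, y, z)) has_derivative (\<lambda>c. (0, 0, c))) (at 0)"
    by (auto intro!: derivative_eq_intros)
  from has_derivative_compose[OF this H_fun_has_derivative[OF assms]]
  have "((\<lambda>z. H_fun l m (x, y, z)) has_derivative (*) ?D) (at 0)" by simp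
  hence "((\<lambda>z. H_fun l m (x, y, z)) has_field_derivative ?D) (at 0)"
    by (simp add: has_field_derivative_def)
  thus ?thesis by (simp add: F_fun_def DERIV_imp_deriv)
qed

lemma GDERIV_H_fun:
  assumes "m \<le> l"
  shows "GDERIV (H_fun l m) (x, y, 0) :> (0, 0, F_fun l m (x, y))"
  using H_fun_has_derivative[OF assms, of x y]
  by (simp add: gderiv_def F_fun_eq[OF assms] case_prod_unfold inner_prod_def mult_ac)

subsection \<open>Expansion in monomials\<close>

lemma F_fun_triangular:
  assumes "1 \<le> m" "m \<le> l"
  obtains c :: "nat \<Rightarrow> real" where "c 0 \<noteq> 0"
    "F_fun l m = (\<Sum>i\<le>(l - m) div 2. c i *\<^sub>R bimonom (l - m - 2 * i) (m - 1 + 2 * i))"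
proof
  define N where "N = sqrt (2 * fact (l - m) / fact (l + m)) * real m"
  define K where "K = (l - m) div 2"
  \<comment> \<open>The binomial expansion of \<open>(x^2 + y^2) ^ k\<close> contributes
    \<open>k choose i\<close> to the power \<open>y ^ (2 * i)\<close>. For \<open>i = 0\<close> this
    is 1, leaving \<open>N\<close> times the nonzero sum of the \<open>gamma_coeff\<close>.\<close>
  define c where "c = (\<lambda>i. N * (\<Sum>k\<le>K. gamma_coeff l m k * real (k choose i)))"
  show "c 0 \<noteq> 0"
    using assms sum_gamma_coeff_neq_0[of m l] by (simp add: c_def N_def K_def)
  have expand: "(x\<^sup>2 + y\<^sup>2) ^ k * x ^ (l - 2 * k - m)
      = (\<Sum>i\<le>K. real (k choose i) * (x ^ (l - m - 2 * i) * y ^ (2 * i)))" if "k \<le> K" for k x y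
  proof -
    have k: "2 * k + m \<le> l" using that assms by (auto simp: K_def)
    have "(x\<^sup>2 + y\<^sup>2) ^ k * x ^ (l - 2 * k - m)
        = (\<Sum>i\<le>k. real (k choose i) * (y\<^sup>2) ^ i * (x\<^sup>2) ^ (k - i)) * x ^ (l - 2 * k - m)"
      using binomial_ring[of "y\<^sup>2" "x\<^sup>2" k] by (simp add: add.commute)
    also have "\<dots> = (\<Sum>i\<le>k. real (k choose i) * (x ^ (l - m - 2 * i) * y ^ (2 * i)))"
      unfolding sum_distrib_right
    proof (intro sum.cong refl)
      fix i assume "i \<in> {..k}"
      hence e: "l - m - 2 * i = 2 * (k - i) + (l - 2 * k - m)" using k by auto
      show "real (k choose i) * (y\<^sup>2) ^ i * (x\<^sup>2) ^ (k - i) * x ^ (l - 2 * k - m)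
          = real (k choose i) * (x ^ (l - m - 2 * i) * y ^ (2 * i))"
        unfolding e by (simp add: power_add mult_ac flip: power_mult)
    qed
    \<comment> \<open>\<open>k choose i\<close> vanishes for \<open>i > k\<close>; a range
      independent of \<open>k\<close> allows the double sum to be swapped later.\<close>
    also have "\<dots> = (\<Sum>i\<le>K. real (k choose i) * (x ^ (l - m - 2 * i) * y ^ (2 * i)))"
      using that by (intro sum.mono_neutral_left) auto
    finally show ?thesis .
  qed
  show "F_fun l m = (\<Sum>i\<le>(l - m) div 2. c i *\<^sub>R bimonom (l - m - 2 * i) (m - 1 + 2 * i))"
  proof (rule ext, clarify)
    fix x y :: real
    have "sqrt (x\<^sup>2 + y\<^sup>2) = 0 \<Longrightarrow> x = 0" by (simp add: add_nonneg_eq_0_iff)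
    moreover have "sqrt (x\<^sup>2 + y\<^sup>2) ^ (2 * k) = (x\<^sup>2 + y\<^sup>2) ^ k" for k
      by (simp add: power_mult)
    ultimately have "F_fun l m (x, y) = N * y ^ (m - 1) *
        (\<Sum>k\<le>K. gamma_coeff l m k * ((x\<^sup>2 + y\<^sup>2) ^ k * x ^ (l - 2 * k - m)))"
      unfolding F_fun_eq[OF assms(2)]
      by (subst Pi_poly_eq_sum[OF assms(2)]) (simp_all add: N_def K_def mult_ac)
    also have "\<dots> = N * y ^ (m - 1) * (\<Sum>k\<le>K. \<Sum>i\<le>K.
        gamma_coeff l m k * real (k choose i) * (x ^ (l - m - 2 * i) * y ^ (2 * i)))"
      by (intro arg_cong2[where f = "(*)"] refl sum.cong)
        (simp only: expand sum_distrib_left mult.assoc atMost_iff)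
    also have "\<dots> = (\<Sum>i\<le>K. c i * (x ^ (l - m - 2 * i) * y ^ (m - 1 + 2 * i)))"
      by (subst sum.swap)
        (simp add: c_def sum_distrib_left sum_distrib_right power_add mult_ac)
    also have "\<dots> = (\<Sum>i\<le>(l - m) div 2.
        c i *\<^sub>R bimonom (l - m - 2 * i) (m - 1 + 2 * i)) (x, y)"
      by (simp add: sum_fun_apply scaleR_fun_apply bimonom_def K_def)
    finally show "F_fun l m (x, y) = (\<Sum>i\<le>(l - m) div 2.
        c i *\<^sub>R bimonom (l - m - 2 * i) (m - 1 + 2 * i)) (x, y)" .
  qed
qed

text \<open>Back substitution in the triangular system: each term with \<open>i > 0\<close> in the
  expansion of \<open>F_fun l m\<close> is the leading monomial for \<open>m + 2 * i\<close>, which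
  is closer to \<open>l\<close>.\<close>

lemma bimonom_in_span_F_fun:
  assumes "1 \<le> m" "m \<le> l"
  shows "bimonom (l - m) (m - 1) \<in> span {F_fun l m | m. m \<in> {1..l}}"
  using assms
proof (induction "l - m" arbitrary: m rule: less_induct)
  case less
  let ?S = "span {F_fun l m | m. m \<in> {1..l}}"
  obtain c :: "nat \<Rightarrow> real" where c: "c 0 \<noteq> 0"
    "F_fun l m = (\<Sum>i\<le>(l - m) div 2. c i *\<^sub>R bimonom (l - m - 2 * i) (m - 1 + 2 * i))"
    using F_fun_triangular[OF less.prems] by blast
  have "bimonom (l - m - 2 * i) (m - 1 + 2 * i) \<in> ?S" if "i \<in> {..(l - m) div 2} - {0}" for i
    using less.hyps[of "m + 2 * i"] that less.prems by auto
  hence "(\<Sum>i\<in>{..(l - m) div 2} - {0}. c i *\<^sub>R bimonom (l - m - 2 * i) (m - 1 + 2 * i)) \<in> ?S"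
    by (intro span_sum span_scale) auto
  moreover have "F_fun l m \<in> ?S" using less.prems by (intro span_base) auto
  moreover have "c 0 *\<^sub>R bimonom (l - m) (m - 1) = F_fun l m -
      (\<Sum>i\<in>{..(l - m) div 2} - {0}. c i *\<^sub>R bimonom (l - m - 2 * i) (m - 1 + 2 * i))"
    unfolding c(2) by (subst sum.remove[of _ 0]) auto
  ultimately have "c 0 *\<^sub>R bimonom (l - m) (m - 1) \<in> ?S" by (simp only: span_diff)
  from span_scale[OF this, of "1 / c 0"] show ?case using c(1) by simp
qed

theorem theorem3p1:
  shows "(\<forall>l m :: nat. \<forall>x y :: real. 1 \<le> m \<and> m \<le> l \<longrightarrow>
        GDERIV (H_fun l m) (x, y, 0) :> (0, 0, F_fun l m (x, y))) \<and>
    (\<forall>p :: nat. 1 \<le> p \<longrightarrow>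
        span {F_fun l m | l m. l \<in> {1..p} \<and> m \<in> {1..l}} =
          span {(\<lambda>(x :: real, y :: real). x ^ i * y ^ j) | i j :: nat. i + j \<le> p - 1} \<and>
        inj_on (\<lambda>(l, m). F_fun l m) {(l, m). l \<in> {1..p} \<and> m \<in> {1..l}} \<and>
        independent {F_fun l m | l m. l \<in> {1..p} \<and> m \<in> {1..l}})"
proof (intro conjI allI impI)
  fix l m :: nat and x y :: real
  assume "1 \<le> m \<and> m \<le> l"
  thus "GDERIV (H_fun l m) (x, y, 0) :> (0, 0, F_fun l m (x, y))" by (simp add: GDERIV_H_fun)
next
  fix p :: nat
  assume p: "1 \<le> p"
  define I where "I = {(l, m). l \<in> {1..p} \<and> m \<in> {1..l}}"
  define J where "J = {(i, j). i + j \<le> p - 1}"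
  let ?T = "{F_fun l m | l m. l \<in> {1..p} \<and> m \<in> {1..l}}"
  let ?M = "{(\<lambda>(x :: real, y :: real). x ^ i * y ^ j) | i j :: nat. i + j \<le> p - 1}"
  have T: "?T = (\<lambda>(l, m). F_fun l m) ` I" by (auto simp: I_def image_iff)
  have M: "?M = case_prod bimonom ` J"
  proof -
    have "?M = {bimonom i j | i j. i + j \<le> p - 1}" by (simp only: bimonom_def)
    thus ?thesis by (auto simp: J_def image_iff)
  qed
  \<comment> \<open>Each index pair goes to the exponents of its leading monomial, of total degree
    \<open>l - 1\<close>.\<close>
  have bij: "bij_betw (\<lambda>(l, m). (l - m, m - 1)) I J"
    by (rule bij_betwI[where g = "\<lambda>(i, j). (i + j + 1, j + 1)"])
      (use p in \<open>auto simp: I_def J_def\<close>)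
  have "finite I" by (rule finite_subset[of _ "{1..p} \<times> {1..p}"]) (auto simp: I_def)
  hence "finite J" using bij bij_betw_finite by blast
  have card_M: "card ?M = card I"
    using bij_betw_same_card[OF bij] card_image[OF inj_on_subset[OF inj_bimonom]] M by simp
  have indep_M: "independent ?M" unfolding M by (rule independent_bimonom) fact
  have "?T \<subseteq> span ?M"
  proof clarify
    fix l m assume lm: "l \<in> {1..p}" "m \<in> {1..l}"
    then obtain c :: "nat \<Rightarrow> real" where c:
      "F_fun l m = (\<Sum>i\<le>(l - m) div 2. c i *\<^sub>R bimonom (l - m - 2 * i) (m - 1 + 2 * i))"
      using F_fun_triangular[of m l] by auto
    have "bimonom (l - m - 2 * i) (m - 1 + 2 * i) \<in> ?M" if "i \<le> (l - m) div 2" for i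
      unfolding M using that lm
      by (intro image_eqI[of _ _ "(l - m - 2 * i, m - 1 + 2 * i)"]) (auto simp: J_def)
    thus "F_fun l m \<in> span ?M"
      unfolding c by (intro span_sum span_scale span_base) auto
  qed
  moreover have M_sub: "?M \<subseteq> span ?T"
  proof
    fix f assume "f \<in> ?M"
    then obtain l m where lm: "(l, m) \<in> I" "f = bimonom (l - m) (m - 1)"
      unfolding M bij_betw_imp_surj_on[OF bij, symmetric] by auto
    hence "f \<in> span {F_fun l m | m. m \<in> {1..l}}"
      using bimonom_in_span_F_fun[of m l] by (auto simp: I_def)
    also have "\<dots> \<subseteq> span ?T" using lm(1) by (intro span_mono) (auto simp: I_def)
    finally show "f \<in> span ?T" .
  qed
  ultimately show "span ?T = span ?M" by (simp add: span_eq)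
  have "finite ?T" unfolding T using \<open>finite I\<close> by simp
  \<comment> \<open>The chain \<open>card I = card ?M \<le> card ?T \<le> card I\<close> forces
    equality, which yields both injectivity of the indexing and independence of
    \<open>?T\<close>.\<close>
  have "card ?M \<le> card ?T"
    using independent_span_bound[OF \<open>finite ?T\<close> indep_M M_sub] by simp
  moreover have "card ?T \<le> card I" unfolding T by (rule card_image_le) fact
  ultimately have card_T: "card ?T = card I" using card_M by simp
  show "inj_on (\<lambda>(l, m). F_fun l m) {(l, m). l \<in> {1..p} \<and> m \<in> {1..l}}"
    using eq_card_imp_inj_on[OF \<open>finite I\<close>] card_T unfolding T I_def by simp
  show "independent ?T"
    by (rule independent_card_le_spanning[OF \<open>finite ?T\<close> indep_M M_sub]) (simp only: card_T card_M order_refl)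
qed

end
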